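(* Let $(\mathcal{M},d)$ be a Ptolemaic metric space. Then for every finite simple undirected graph $G$ and every choice of finite nonempty uncertainty sets $\mathcal{U}_i\subseteq\mathcal{M}$, $i\in V[G]$, we have $c^{max}(G)\leq 4\,c(G)$.
   Context: A metric space $(\mathcal{M},d)$ is Ptolemaic if for all $A,B,C,D\in\mathcal{M}$, $d(A,C)d(B,D)\le d(A,B)d(C,D)+d(B,C)d(A,D)$. For a graph $G$ with a finite nonempty set $\mathcal{U}_i\subseteq\mathcal{M}$ attached to each vertex $i$, let $\mathcal{U}=\prod_i\mathcal{U}_i$, $c(G)=\max_{u\in\mathcal{U}}\sum_{\{i,j\}\in E[G]}d(u_i,u_j)$, $d^{max}_{ij}=\max_{u_i\in\mathcal{U}_i,u_j\in\mathcal{U}_j}d(u_i,u_j)$ and $c^{max}(G)=\sum_{\{i,j\}\in E[G]}d^{max}_{ij}$. *)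

theory Defs
  imports "HOL-Analysis.Analysis"
begin

locale Ptolemaic_space = Metric_space M d for M :: "'a set" and d :: "'a \<Rightarrow> 'a \<Rightarrow> real" +
  assumes ptolemy:
    "\<And>A B C D. \<lbrakk>A \<in> M; B \<in> M; C \<in> M; D \<in> M\<rbrakk> \<Longrightarrow>
       d A C * d B D \<le> d A B * d C D + d B C * d A D"

locale finite_simple_graph =
  fixes V :: "'v set" and E :: "'v set set"
  assumes finite_V: "finite V"
    and edgeD: "\<And>e. e \<in> E \<Longrightarrow> e \<subseteq> V \<and> card e = 2"

text \<open>Edges are unordered pairs, so \<open>d(u\<^sub>i, u\<^sub>j)\<close> and the like are read off an edge through
  a symmetric function \<open>f\<close> of its endpoints; for such \<open>f\<close> the description below is proper.\<close>

definition on_edge :: "('v \<Rightarrow> 'v \<Rightarrow> real) \<Rightarrow> 'v set \<Rightarrow> real" where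
  "on_edge f e = (THE r. \<exists>i j. e = {i, j} \<and> r = f i j)"

lemma on_edge_insert:
  assumes "f i j = f j i"
  shows "on_edge f {i, j} = f i j"
  unfolding on_edge_def
proof (rule the_equality)
  show "\<exists>i' j'. {i, j} = {i', j'} \<and> f i j = f i' j'" by blast
next
  fix r assume "\<exists>i' j'. {i, j} = {i', j'} \<and> r = f i' j'"
  then show "r = f i j" using assms by (auto simp: doubleton_eq_iff)
qed

definition cost :: "('a \<Rightarrow> 'a \<Rightarrow> real) \<Rightarrow> 'v set set \<Rightarrow> ('v \<Rightarrow> 'a) \<Rightarrow> real" where
  "cost d E u = (\<Sum>e\<in>E. on_edge (\<lambda>i j. d (u i) (u j)) e)"

definition c_opt :: "('a \<Rightarrow> 'a \<Rightarrow> real) \<Rightarrow> 'v set \<Rightarrow> 'v set set \<Rightarrow> ('v \<Rightarrow> 'a set) \<Rightarrow> real" where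
  "c_opt d V E U = Max (cost d E ` (\<Pi>\<^sub>E i\<in>V. U i))"

definition d_max :: "('a \<Rightarrow> 'a \<Rightarrow> real) \<Rightarrow> ('v \<Rightarrow> 'a set) \<Rightarrow> 'v \<Rightarrow> 'v \<Rightarrow> real" where
  "d_max d U i j = Max ((\<lambda>(x, y). d x y) ` (U i \<times> U j))"

definition c_max :: "('a \<Rightarrow> 'a \<Rightarrow> real) \<Rightarrow> 'v set set \<Rightarrow> ('v \<Rightarrow> 'a set) \<Rightarrow> real" where
  "c_max d E U = (\<Sum>e\<in>E. on_edge (d_max d U) e)"

lemma (in Metric_space) d_max_commute: "d_max d U i j = d_max d U j i"
proof -
  have "(\<lambda>(x, y). d x y) ` (U i \<times> U j) = (\<lambda>(x, y). d x y) ` (U j \<times> U i)"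
    using commute by (force simp: image_iff)
  then show ?thesis by (simp add: d_max_def)
qed

lemma (in Metric_space) on_edge_dist: "on_edge (\<lambda>i j. d (u i) (u j)) {i, j} = d (u i) (u j)"
  by (rule on_edge_insert) (rule commute)

lemma (in Metric_space) on_edge_d_max: "on_edge (d_max d U) {i, j} = d_max d U i j"
  by (rule on_edge_insert) (rule d_max_commute)

end

theory Submission
  imports Defs
begin

text \<open>
  Pick a diametral pair \<open>a\<^sub>i, b\<^sub>i\<close> of every \<open>U\<^sub>i\<close>. Ptolemy's inequality gives
  \<open>d(x, z) \<le> d(a\<^sub>i, z) + d(b\<^sub>i, z)\<close> for all \<open>x\<close> in \<open>U\<^sub>i\<close> and all points \<open>z\<close>. Applied at both ends of an
  edge, this bounds \<open>d\<^sup>m\<^sup>a\<^sup>x\<^sub>i\<^sub>j\<close> by the sum of the four distances between \<open>{a\<^sub>i, b\<^sub>i}\<close> and \<open>{a\<^sub>j, b\<^sub>j}\<close>,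
  that is, by four times the expected distance when the endpoints are chosen uniformly and
  independently from their diametral pairs. Hence a uniformly random choice of the points
  has expected cost at least \<open>c\<^sup>m\<^sup>a\<^sup>x(G) / 4\<close>.
\<close>

text \<open>In the quadrilateral \<open>x\<close>, \<open>a\<close>, \<open>z\<close>,
  \<open>b\<close> with diagonals \<open>x z\<close> and \<open>a b\<close>, both sides at
  \<open>x\<close> are at most \<open>d a b\<close>, so this factor cancels from Ptolemy's
  inequality. If it vanishes, \<open>x = a\<close>.\<close>

lemma (in Ptolemaic_space) dist_le_sum_diametral:
  assumes "a \<in> M" "b \<in> M" "x \<in> M" "z \<in> M"
    and "d x a \<le> d a b" "d x b \<le> d a b"
  shows "d x z \<le> d a z + d b z"
proof (cases "d a b = 0")
  case True
  then have "x = a" using assms by (metis nonneg order_antisym zero)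
  then show ?thesis by simp
next
  case False
  then have pos: "d a b > 0" using nonneg[of a b] by linarith
  have "d x z * d a b \<le> d x a * d z b + d a z * d x b"
    using ptolemy assms by blast
  also have "\<dots> \<le> d a b * d z b + d a z * d a b"
    using assms by (intro add_mono mult_right_mono mult_left_mono) auto
  also have "\<dots> = (d a z + d b z) * d a b"
    by (simp add: commute algebra_simps)
  finally show ?thesis using pos by simp
qed

lemma (in Metric_space) finite_diametral_pair:
  assumes "finite S" "S \<noteq> {}"
  obtains a b where "a \<in> S" "b \<in> S" "\<And>x y. x \<in> S \<Longrightarrow> y \<in> S \<Longrightarrow> d x y \<le> d a b"
proof -
  let ?D = "(\<lambda>(x, y). d x y) ` (S \<times> S)"
  have D: "finite ?D" "?D \<noteq> {}" using assms by auto
  obtain a b where ab: "a \<in> S" "b \<in> S" "d a b = Max ?D"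
    using Max_in[OF D] by auto
  have "d x y \<le> d a b" if "x \<in> S" "y \<in> S" for x y
    unfolding ab(3) using that D(1) by (intro Max_ge) auto
  with ab show thesis using that by blast
qed

lemma sum_Pow_sym_diff:
  assumes "A \<subseteq> V"
  shows "(\<Sum>T\<in>Pow V. g (sym_diff T A)) = (\<Sum>T\<in>Pow V. g T)"
  by (rule sum.reindex_bij_witness[where i="\<lambda>T. sym_diff T A" and j="\<lambda>T. sym_diff T A"])
    (use assms in \<open>auto intro!: arg_cong[where f=g]\<close>)

text \<open>In a uniformly random subset of \<open>V\<close>, membership of two distinct elements
  behaves like two independent fair coins.\<close>

lemma sum_Pow_pair:
  fixes h :: "bool \<Rightarrow> bool \<Rightarrow> real"
  assumes "i \<in> V" "j \<in> V" "i \<noteq> j"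
  shows "4 * (\<Sum>T\<in>Pow V. h (i \<in> T) (j \<in> T)) =
    real (card (Pow V)) * (h True True + h True False + h False True + h False False)"
proof -
  define g where "g T = h (i \<in> T) (j \<in> T)" for T
  \<comment> \<open>Toggling nothing, \<open>i\<close>, \<open>j\<close> or both runs through all
    four membership patterns, whatever \<open>T\<close> is; each toggle permutes
    \<open>Pow V\<close>.\<close>
  have four: "g T + g (sym_diff T {i}) + g (sym_diff T {j}) + g (sym_diff T {i, j}) =
      h True True + h True False + h False True + h False False" for T
    using assms(3) by (cases "i \<in> T"; cases "j \<in> T") (simp_all add: g_def)
  have "4 * (\<Sum>T\<in>Pow V. g T) =
    (\<Sum>T\<in>Pow V. g T + g (sym_diff T {i}) + g (sym_diff T {j}) + g (sym_diff T {i, j}))"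
    using assms by (simp only: sum.distrib sum_Pow_sym_diff insert_subset empty_subsetI)
  then show ?thesis unfolding four by (simp add: g_def)
qed

theorem theorem3:
  fixes M :: "'a set" and d :: "'a \<Rightarrow> 'a \<Rightarrow> real"
    and V :: "'v set" and E :: "'v set set" and U :: "'v \<Rightarrow> 'a set"
  assumes "Ptolemaic_space M d"
    and "finite_simple_graph V E"
    and "\<And>i. i \<in> V \<Longrightarrow> finite (U i) \<and> U i \<noteq> {} \<and> U i \<subseteq> M"
  shows "c_max d E U \<le> 4 * c_opt d V E U"
proof -
  interpret Ptolemaic_space M d by fact
  interpret finite_simple_graph V E by fact
  have "\<forall>i\<in>V. \<exists>p. fst p \<in> U i \<and> snd p \<in> U i \<and> (\<forall>x\<in>U i. \<forall>y\<in>U i. d x y \<le> d (fst p) (snd p))"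
    using finite_diametral_pair assms(3) by (metis fst_conv snd_conv)
  then obtain p where p: "\<And>i. i \<in> V \<Longrightarrow> fst (p i) \<in> U i \<and> snd (p i) \<in> U i \<and>
      (\<forall>x\<in>U i. \<forall>y\<in>U i. d x y \<le> d (fst (p i)) (snd (p i)))"
    by metis
  define a b where "a i = fst (p i)" and "b i = snd (p i)" for i
  have ab: "a i \<in> U i" "b i \<in> U i" if "i \<in> V" for i
    using p that by (auto simp: a_def b_def)
  have M: "x \<in> M" if "x \<in> U i" "i \<in> V" for x i
    using assms(3) that by blast
  have split: "d x z \<le> d (a i) z + d (b i) z" if "i \<in> V" "x \<in> U i" "z \<in> M" for i x z
    using that ab[OF that(1)] M p[OF that(1)]
    by (intro dist_le_sum_diametral) (auto simp: a_def b_def)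
  \<comment> \<open>A subset \<open>T\<close> of \<open>V\<close> encodes one outcome of the random
    choice: \<open>a i\<close> on \<open>T\<close>, \<open>b i\<close> off it.\<close>
  define u where "u T = (\<lambda>i\<in>V. if i \<in> T then a i else b i)" for T
  have u: "u T \<in> (\<Pi>\<^sub>E i\<in>V. U i)" for T
    using ab by (auto simp: u_def)
  have edge: "real (card (Pow V)) * on_edge (d_max d U) e \<le>
      4 * (\<Sum>T\<in>Pow V. on_edge (\<lambda>i j. d (u T i) (u T j)) e)" if eE: "e \<in> E" for e
  proof -
    obtain i j where e: "e = {i, j}" "i \<noteq> j" and ij: "i \<in> V" "j \<in> V"
      using edgeD[OF eE] by (auto simp: card_2_iff)
    have "d x y \<le> d (a i) (a j) + d (a i) (b j) + d (b i) (a j) + d (b i) (b j)"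
      if xy: "x \<in> U i" "y \<in> U j" for x y
    proof -
      \<comment> \<open>Split at the end \<open>j\<close> first, with \<open>x\<close> as the
        outside point; then at \<open>i\<close>, with \<open>a j\<close> and \<open>b j\<close> as
        outside points.\<close>
      have "d x y \<le> d x (a j) + d x (b j)"
        using split[OF ij(2) xy(2) M[OF xy(1) ij(1)]] by (simp add: commute)
      then show ?thesis
        using split[OF ij(1) xy(1) M[OF ab(1)[OF ij(2)] ij(2)]]
          split[OF ij(1) xy(1) M[OF ab(2)[OF ij(2)] ij(2)]] by linarith
    qed
    then have max: "d_max d U i j \<le>
        d (a i) (a j) + d (a i) (b j) + d (b i) (a j) + d (b i) (b j)"
      unfolding d_max_def using assms(3) ij by (subst Max_le_iff) auto
    have "4 * (\<Sum>T\<in>Pow V. d (u T i) (u T j)) =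
        real (card (Pow V)) * (d (a i) (a j) + d (a i) (b j) + d (b i) (a j) + d (b i) (b j))"
      using sum_Pow_pair[OF ij e(2),
          of "\<lambda>s t. d (if s then a i else b i) (if t then a j else b j)"] ij
      by (simp add: u_def)
    then show ?thesis
      using max unfolding e(1) on_edge_dist on_edge_d_max by (simp add: mult_left_mono)
  qed
  \<comment> \<open>Linearity of expectation, multiplied through by the number of outcomes: swap the
    sums over edges and subsets.\<close>
  have "real (card (Pow V)) * c_max d E U \<le> 4 * (\<Sum>T\<in>Pow V. cost d E (u T))"
    unfolding c_max_def cost_def sum_distrib_left
    by (subst sum.swap) (use edge in \<open>auto intro!: sum_mono simp: sum_distrib_left simp del: card_Pow\<close>)
  \<comment> \<open>No outcome costs more than the maximum.\<close>
  also have "\<dots> \<le> 4 * (\<Sum>T\<in>Pow V. c_opt d V E U)"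
  proof -
    have "finite (\<Pi>\<^sub>E i\<in>V. U i)"
      using finite_V assms(3) by (intro finite_PiE) auto
    then have "cost d E (u T) \<le> c_opt d V E U" for T
      unfolding c_opt_def using u by (intro Max_ge) auto
    then show ?thesis by (intro mult_left_mono sum_mono) auto
  qed
  also have "\<dots> = real (card (Pow V)) * (4 * c_opt d V E U)"
    by simp
  finally show ?thesis
    using finite_V by (simp add: card_Pow)
qed

end
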